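(* For every integer $n \ge 2$ one has $\iota_n(\mathcal L_n) \subset \mathcal L_{n+1}$, where $\mathcal L_n \subset \mathbb C[S_n]$ is the set of Lie elements with respect to the permutation representation $\mathbb C^n$ of $S_n$ and $\iota_n : \mathbb C[S_n] \to \mathbb C[S_{n+1}]$ is the algebra homomorphism induced by the standard embedding $S_n \to S_{n+1}$.
   Context: Let $V$ be a finite-dimensional representation of a group $G$ over a field $k$. For $g \in G$ and $m \ge 1$ define linear operators $A_m(g), B_m(g): V^{\wedge m} \to V^{\wedge m}$ on the $m$-th exterior power by $$A_m(g)(v_1 \wedge \dots \wedge v_m) = g(v_1) \wedge \dots \wedge g(v_m),$$ $$B_m(g)(v_1 \wedge \dots \wedge v_m) = \sum_{p=1}^m v_1 \wedge \dots \wedge g(v_p) \wedge \dots \wedge v_m$$ (in the $p$-th summand only $v_p$ is replaced by $g(v_p)$). For $m = 0$ set $A_0(g) = 1$ and $B_0(g) = 0$ as operators $k \to k$. Extend $A_m$ and $B_m$ by $k$-linearity to maps $k[G] \to \operatorname{End}(V^{\wedge m})$. An element $x \in k[G]$ is called a Lie element (with respect to $V$) if $A_m(x) = B_m(x)$ for all $m = 0, 1, \dots, \dim V$; the set of Lie elements is denoted $\mathcal L(V)$. For $G = S_n$, $k = \mathbb C$, let $\mathbb C^n$ be the permutation representation: $S_n$ permutes the basis $x_1, \dots, x_n$ by $\sigma(x_i) = x_{\sigma(i)}$. Write $\mathcal L_n = \mathcal L(\mathbb C^n) \subset \mathbb C[S_n]$. The standard embedding $\iota_n: S_n \to S_{n+1}$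 is given by $\iota_n(\sigma)(k) = \sigma(k)$ for $1 \le k \le n$ and $\iota_n(\sigma)(n+1) = n+1$; it is extended by linearity to $\iota_n : \mathbb C[S_n] \to \mathbb C[S_{n+1}]$. *)

theory Defs
  imports Complex_Main "HOL-Library.Poly_Mapping" "HOL-Algebra.Module" "HOL-Algebra.Sym_Groups"
begin

section \<open>Free vector spaces\<close>

text \<open>
  The finitely supported functions from a type \<open>'a\<close> to a field form the vector space with basis
  \<open>'a\<close>, and those with keys in a set \<open>A\<close> form the one with basis \<open>A\<close>. This encodes \<open>\<complex>\<^sup>n\<close>
  (on the set \<open>{1..n}\<close>), the group algebra (on the carrier of the group), and the free vector space
  on \<open>m\<close>-tuples of vectors of which the exterior power is a quotient.
\<close>

definition fscale :: "'k::field \<Rightarrow> ('a \<Rightarrow>\<^sub>0 'k) \<Rightarrow> ('a \<Rightarrow>\<^sub>0 'k)"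
  where "fscale c f = Poly_Mapping.map ((*) c) f"

abbreviation fvec :: "'a \<Rightarrow> ('a \<Rightarrow>\<^sub>0 'k::field)"
  where "fvec a \<equiv> Poly_Mapping.single a 1"

definition free_on :: "'a set \<Rightarrow> ('a \<Rightarrow>\<^sub>0 'k::field) set"
  where "free_on A = {f. Poly_Mapping.keys f \<subseteq> A}"

text \<open>The linear map that sends each basis vector \<open>fvec a\<close> to \<open>\<phi> a\<close>.\<close>

definition lin_ext :: "('a \<Rightarrow> ('b \<Rightarrow>\<^sub>0 'k::field)) \<Rightarrow> ('a \<Rightarrow>\<^sub>0 'k) \<Rightarrow> ('b \<Rightarrow>\<^sub>0 'k)"
  where "lin_ext \<phi> f = (\<Sum>a\<in>Poly_Mapping.keys f. fscale (Poly_Mapping.lookup f a) (\<phi> a))"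

lemma lookup_fscale [simp]:
  "Poly_Mapping.lookup (fscale c f) a = c * Poly_Mapping.lookup f a"
  by (simp add: fscale_def Poly_Mapping.map.rep_eq when_def)

lemma keys_fscale: "Poly_Mapping.keys (fscale c f) \<subseteq> Poly_Mapping.keys f"
  by (auto simp del: lookup_not_eq_zero_eq_in_keys simp: in_keys_iff)

global_interpretation free: vector_space "fscale :: 'k::field \<Rightarrow> ('a \<Rightarrow>\<^sub>0 'k) \<Rightarrow> ('a \<Rightarrow>\<^sub>0 'k)"
  by unfold_locales (auto intro!: poly_mapping_eqI simp: lookup_add algebra_simps)

lemma free_on_subspace: "free.subspace (free_on A)"
proof (rule free.subspaceI)
  show "fscale c f \<in> free_on A" if "f \<in> free_on A" for c f
    using that keys_fscale[of c f] by (auto simp: free_on_def)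
  show "f + g \<in> free_on A" if "f \<in> free_on A" "g \<in> free_on A" for f g
    using that keys_add[of f g] by (auto simp: free_on_def)
qed (simp add: free_on_def)

lemma fvec_in_free_on: "fvec a \<in> free_on A \<longleftrightarrow> a \<in> A"
  by (simp add: free_on_def)

lemma lin_ext_superset:
  assumes "finite S" "Poly_Mapping.keys f \<subseteq> S"
  shows "lin_ext \<phi> f = (\<Sum>a\<in>S. fscale (Poly_Mapping.lookup f a) (\<phi> a))"
  unfolding lin_ext_def
  by (rule sum.mono_neutral_left) (use assms in \<open>auto simp: not_in_keys_iff_lookup_eq_zero\<close>)

lemma lin_ext_add: "lin_ext \<phi> (f + g) = lin_ext \<phi> f + lin_ext \<phi> g"
proof -
  let ?S = "Poly_Mapping.keys f \<union> Poly_Mapping.keys g"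
  have "Poly_Mapping.keys (f + g) \<subseteq> ?S" by (rule keys_add)
  then show ?thesis
    by (simp add: lin_ext_superset[of ?S] lookup_add free.scale_left_distrib sum.distrib)
qed

lemma lin_ext_scale: "lin_ext \<phi> (fscale c f) = fscale c (lin_ext \<phi> f)"
  by (simp add: lin_ext_superset[of "Poly_Mapping.keys f"] keys_fscale free.scale_sum_right)

lemma lin_ext_0 [simp]: "lin_ext \<phi> 0 = 0"
  by (simp add: lin_ext_def)

lemma lin_ext_fvec [simp]: "lin_ext \<phi> (fvec a) = \<phi> a"
  by (simp add: lin_ext_def)

lemma lin_ext_sum: "lin_ext \<phi> (\<Sum>s\<in>S. h s) = (\<Sum>s\<in>S. lin_ext \<phi> (h s))"
  by (induction S rule: infinite_finite_induct) (simp_all add: lin_ext_add)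

lemma lin_ext_diff: "lin_ext \<phi> (f - g) = lin_ext \<phi> f - lin_ext \<phi> g"
  by (metis add_diff_cancel_right' diff_add_cancel lin_ext_add)

lemma lin_ext_in_free_on:
  assumes "\<And>a. a \<in> A \<Longrightarrow> \<phi> a \<in> free_on B" "f \<in> free_on A"
  shows "lin_ext \<phi> f \<in> free_on B"
  unfolding lin_ext_def
  by (intro free.subspace_sum free.subspace_scale free_on_subspace assms(1))
     (use assms(2) in \<open>auto simp: free_on_def\<close>)

lemma lin_ext_self: "lin_ext fvec f = f"
proof (rule poly_mapping_eqI)
  fix k
  have "Poly_Mapping.lookup (lin_ext fvec f) k =
      (\<Sum>x\<in>Poly_Mapping.keys f. Poly_Mapping.lookup f x * Poly_Mapping.lookup (fvec x) k)"
    by (simp only: lin_ext_def lookup_sum lookup_fscale)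
  also have "\<dots> = (\<Sum>x\<in>Poly_Mapping.keys f. if k = x then Poly_Mapping.lookup f x else 0)"
    by (rule sum.cong[OF refl]) (simp add: lookup_single when_def)
  also have "\<dots> = (if k \<in> Poly_Mapping.keys f then Poly_Mapping.lookup f k else 0)"
    by (rule sum.delta'[OF finite_keys])
  also have "\<dots> = Poly_Mapping.lookup f k"
    by (cases "k \<in> Poly_Mapping.keys f") (simp_all add: not_in_keys_iff_lookup_eq_zero)
  finally show "Poly_Mapping.lookup (lin_ext fvec f) k = Poly_Mapping.lookup f k" .
qed


section \<open>Representations and exterior powers\<close>

locale fd_representation =
  vector_space scale + group G
  for scale :: "'k::field \<Rightarrow> 'v::ab_group_add \<Rightarrow> 'v" and G :: "('g, 'z) monoid_scheme" (structure) +
  fixes V :: "'v set" and \<rho> :: "'g \<Rightarrow> 'v \<Rightarrow> 'v"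
  assumes V_subspace: "subspace V"
    and V_finite_dim: "\<exists>B. finite B \<and> span B = V"
    and \<rho>_closed: "\<lbrakk>g \<in> carrier G; v \<in> V\<rbrakk> \<Longrightarrow> \<rho> g v \<in> V"
    and \<rho>_add: "\<lbrakk>g \<in> carrier G; v \<in> V; w \<in> V\<rbrakk> \<Longrightarrow> \<rho> g (v + w) = \<rho> g v + \<rho> g w"
    and \<rho>_scale: "\<lbrakk>g \<in> carrier G; v \<in> V\<rbrakk> \<Longrightarrow> \<rho> g (scale c v) = scale c (\<rho> g v)"
    and \<rho>_one: "v \<in> V \<Longrightarrow> \<rho> \<one> v = v"
    and \<rho>_mult: "\<lbrakk>g \<in> carrier G; h \<in> carrier G; v \<in> V\<rbrakk> \<Longrightarrow> \<rho> (g \<otimes> h) v = \<rho> g (\<rho> h v)"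
begin

definition tuples :: "nat \<Rightarrow> 'v list set"
  where "tuples m = {vs. length vs = m \<and> set vs \<subseteq> V}"

text \<open>
  The relations that make the class of \<open>fvec [v\<^sub>1, \<dots>, v\<^sub>m]\<close> multilinear and alternating in
  \<open>v\<^sub>1, \<dots>, v\<^sub>m\<close>. For \<open>m = 0\<close> there are none, so that the \<open>0\<close>-th exterior power is spanned freely
  by the class of the empty tuple, i.e. it is the field.
\<close>

definition ext_relators :: "nat \<Rightarrow> ('v list \<Rightarrow>\<^sub>0 'k) set"
  where "ext_relators m =
    {fvec (us @ (v + w) # ws) - fvec (us @ v # ws) - fvec (us @ w # ws) | us v w ws.
       us @ v # ws \<in> tuples m \<and> w \<in> V} \<union>
    {fvec (us @ scale c v # ws) - fscale c (fvec (us @ v # ws)) | us c v ws.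
       us @ v # ws \<in> tuples m} \<union>
    {fvec vs | vs. vs \<in> tuples m \<and> \<not> distinct vs}"

definition ext_rels :: "nat \<Rightarrow> ('v list \<Rightarrow>\<^sub>0 'k) set"
  where "ext_rels m = free.span (ext_relators m)"

definition ext_class :: "nat \<Rightarrow> ('v list \<Rightarrow>\<^sub>0 'k) \<Rightarrow> ('v list \<Rightarrow>\<^sub>0 'k) set"
  where "ext_class m f = {f + r | r. r \<in> ext_rels m}"

text \<open>
  The \<open>m\<close>-th exterior power: free vector space on the \<open>m\<close>-tuples modulo the relations, with cosets
  as elements. The fields \<open>mult\<close> and \<open>one\<close> of the record are irrelevant for a module.
\<close>

definition ext_power :: "nat \<Rightarrow> ('k, ('v list \<Rightarrow>\<^sub>0 'k) set) module"
  where "ext_power m =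
    \<lparr>carrier = ext_class m ` free_on (tuples m), monoid.mult = undefined, one = undefined,
     zero = ext_class m 0,
     add = (\<lambda>X Y. {f + g | f g. f \<in> X \<and> g \<in> Y}),
     smult = (\<lambda>c X. \<Union>f\<in>X. ext_class m (fscale c f))\<rparr>"

definition wedge :: "'v list \<Rightarrow> ('v list \<Rightarrow>\<^sub>0 'k) set"
  where "wedge vs = ext_class (length vs) (fvec vs)"

text \<open>The map on the \<open>m\<close>-th exterior power induced by \<open>lin_ext \<phi>\<close>.\<close>

definition ext_induced ::
  "nat \<Rightarrow> ('v list \<Rightarrow> ('v list \<Rightarrow>\<^sub>0 'k)) \<Rightarrow> ('v list \<Rightarrow>\<^sub>0 'k) set \<Rightarrow> ('v list \<Rightarrow>\<^sub>0 'k) set"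
  where "ext_induced m \<phi> X = (\<Union>f\<in>X. ext_class m (lin_ext \<phi> f))"

text \<open>
  \<open>A_op m g\<close> and \<open>B_op m g\<close> are linear operators on the \<open>m\<close>-th exterior power, and they are
  determined by their values on wedges; this is proved below in the lemmas \<open>A_op_wedge\<close>,
  \<open>B_op_wedge\<close>, \<open>A_op_linear\<close>, \<open>B_op_linear\<close> and \<open>ext_power_eq_span_wedges\<close>.
\<close>

definition A_op :: "nat \<Rightarrow> 'g \<Rightarrow> ('v list \<Rightarrow>\<^sub>0 'k) set \<Rightarrow> ('v list \<Rightarrow>\<^sub>0 'k) set"
  where "A_op m g = ext_induced m (\<lambda>vs. fvec (map (\<rho> g) vs))"

definition B_op :: "nat \<Rightarrow> 'g \<Rightarrow> ('v list \<Rightarrow>\<^sub>0 'k) set \<Rightarrow> ('v list \<Rightarrow>\<^sub>0 'k) set"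
  where "B_op m g = ext_induced m (\<lambda>vs. \<Sum>p<m. fvec (vs[p := \<rho> g (vs ! p)]))"

definition A_alg :: "nat \<Rightarrow> ('g \<Rightarrow>\<^sub>0 'k) \<Rightarrow> ('v list \<Rightarrow>\<^sub>0 'k) set \<Rightarrow> ('v list \<Rightarrow>\<^sub>0 'k) set"
  where "A_alg m x X =
    (\<Oplus>\<^bsub>ext_power m\<^esub>g\<in>Poly_Mapping.keys x. Poly_Mapping.lookup x g \<odot>\<^bsub>ext_power m\<^esub> A_op m g X)"

definition B_alg :: "nat \<Rightarrow> ('g \<Rightarrow>\<^sub>0 'k) \<Rightarrow> ('v list \<Rightarrow>\<^sub>0 'k) set \<Rightarrow> ('v list \<Rightarrow>\<^sub>0 'k) set"
  where "B_alg m x X =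
    (\<Oplus>\<^bsub>ext_power m\<^esub>g\<in>Poly_Mapping.keys x. Poly_Mapping.lookup x g \<odot>\<^bsub>ext_power m\<^esub> B_op m g X)"

definition lie_elements :: "('g \<Rightarrow>\<^sub>0 'k) set"
  where "lie_elements = {x \<in> free_on (carrier G).
    \<forall>m\<in>{0..dim V}. \<forall>X\<in>carrier (ext_power m). A_alg m x X = B_alg m x X}"


subsection \<open>Well-definedness\<close>

lemma ext_rels_subspace: "free.subspace (ext_rels m)"
  by (simp add: ext_rels_def)

lemma ext_relators_0: "ext_relators 0 = {}"
  by (auto simp: ext_relators_def tuples_def)

lemma ext_rels_0: "ext_rels 0 = {0}"
  by (simp add: ext_rels_def ext_relators_0)

lemma ext_class_eq_iff: "ext_class m f = ext_class m g \<longleftrightarrow> f - g \<in> ext_rels m"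
proof
  assume "ext_class m f = ext_class m g"
  moreover have "f \<in> ext_class m f"
    using free.subspace_0[OF ext_rels_subspace, of m] by (force simp: ext_class_def)
  ultimately obtain r where "f = g + r" "r \<in> ext_rels m"
    by (auto simp: ext_class_def)
  then show "f - g \<in> ext_rels m" by simp
next
  assume d: "f - g \<in> ext_rels m"
  show "ext_class m f = ext_class m g"
  proof (intro equalityI subsetI)
    fix y assume "y \<in> ext_class m f"
    then obtain r where r: "y = f + r" "r \<in> ext_rels m" by (auto simp: ext_class_def)
    have "y = g + ((f - g) + r)" by (simp add: r)
    then show "y \<in> ext_class m g"
      unfolding ext_class_def using free.subspace_add[OF ext_rels_subspace d r(2)] by blast
  next
    fix y assume "y \<in> ext_class m g"
    then obtain r where r: "y = g + r" "r \<in> ext_rels m" by (auto simp: ext_class_def)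
    have "y = f + (r - (f - g))" by (simp add: r)
    then show "y \<in> ext_class m f"
      unfolding ext_class_def using free.subspace_diff[OF ext_rels_subspace r(2) d] by blast
  qed
qed

lemma ext_class_self: "f \<in> ext_class m f"
  using free.subspace_0[OF ext_rels_subspace, of m] by (force simp: ext_class_def)

lemma in_ext_class_iff: "y \<in> ext_class m f \<longleftrightarrow> y - f \<in> ext_rels m"
  unfolding ext_class_def by (auto intro: exI[of _ "y - f"])

lemma ext_power_carrier: "carrier (ext_power m) = ext_class m ` free_on (tuples m)"
  by (simp add: ext_power_def)

lemma ext_power_zero: "\<zero>\<^bsub>ext_power m\<^esub> = ext_class m 0"
  by (simp add: ext_power_def)

lemma ext_power_add: "ext_class m f \<oplus>\<^bsub>ext_power m\<^esub> ext_class m g = ext_class m (f + g)"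
proof -
  have "{a + b | a b. a \<in> ext_class m f \<and> b \<in> ext_class m g} = ext_class m (f + g)"
  proof (intro equalityI subsetI)
    fix y assume "y \<in> {a + b | a b. a \<in> ext_class m f \<and> b \<in> ext_class m g}"
    then obtain a b where ab: "y = a + b" "a - f \<in> ext_rels m" "b - g \<in> ext_rels m"
      by (auto simp: in_ext_class_iff)
    from free.subspace_add[OF ext_rels_subspace ab(2,3)]
    show "y \<in> ext_class m (f + g)" by (simp add: in_ext_class_iff ab(1) algebra_simps)
  next
    fix y assume "y \<in> ext_class m (f + g)"
    then have "y - g \<in> ext_class m f" by (simp add: in_ext_class_iff algebra_simps)
    moreover have "y = (y - g) + g" by simp
    ultimately show "y \<in> {a + b | a b. a \<in> ext_class m f \<and> b \<in> ext_class m g}"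
      using ext_class_self by blast
  qed
  then show ?thesis by (simp add: ext_power_def)
qed

lemma ext_class_UN:
  assumes "\<And>r. r \<in> ext_rels m \<Longrightarrow> \<phi> r \<in> ext_rels m" "\<And>f g. \<phi> (f - g) = \<phi> f - \<phi> g"
  shows "(\<Union>h\<in>ext_class m f. ext_class m (\<phi> h)) = ext_class m (\<phi> f)"
proof -
  have "ext_class m (\<phi> h) = ext_class m (\<phi> f)" if "h \<in> ext_class m f" for h
    using assms(1)[of "h - f"] that by (simp add: in_ext_class_iff ext_class_eq_iff assms(2))
  then show ?thesis using ext_class_self[of f m] by blast
qed

lemma ext_power_smult: "c \<odot>\<^bsub>ext_power m\<^esub> ext_class m f = ext_class m (fscale c f)"
  using ext_class_UN[of m "fscale c" f] free.subspace_scale[OF ext_rels_subspace]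
  by (simp add: ext_power_def free.scale_right_diff_distrib)

lemma ext_power_cases:
  assumes "X \<in> carrier (ext_power m)"
  obtains f where "f \<in> free_on (tuples m)" "X = ext_class m f"
  using assms by (auto simp: ext_power_carrier)

lemma ext_class_in_carrier: "f \<in> free_on (tuples m) \<Longrightarrow> ext_class m f \<in> carrier (ext_power m)"
  by (simp add: ext_power_carrier)

lemma ext_power_abelian_group: "abelian_group (ext_power m)"
proof (rule abelian_groupI)
  fix X Y assume X: "X \<in> carrier (ext_power m)" and Y: "Y \<in> carrier (ext_power m)"
  from X obtain f where f: "f \<in> free_on (tuples m)" "X = ext_class m f" by (rule ext_power_cases)
  from Y obtain g where g: "g \<in> free_on (tuples m)" "Y = ext_class m g" by (rule ext_power_cases)
  show "X \<oplus>\<^bsub>ext_power m\<^esub> Y \<in> carrier (ext_power m)"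
    unfolding f g ext_power_add
    by (intro ext_class_in_carrier free.subspace_add[OF free_on_subspace] f g)
  show "X \<oplus>\<^bsub>ext_power m\<^esub> Y = Y \<oplus>\<^bsub>ext_power m\<^esub> X"
    unfolding f g ext_power_add by (simp only: add.commute)
  fix Z assume "Z \<in> carrier (ext_power m)"
  then obtain h where h: "h \<in> free_on (tuples m)" "Z = ext_class m h" by (rule ext_power_cases)
  show "X \<oplus>\<^bsub>ext_power m\<^esub> Y \<oplus>\<^bsub>ext_power m\<^esub> Z = X \<oplus>\<^bsub>ext_power m\<^esub> (Y \<oplus>\<^bsub>ext_power m\<^esub> Z)"
    unfolding f g h ext_power_add by (simp only: add.assoc)
next
  show "\<zero>\<^bsub>ext_power m\<^esub> \<in> carrier (ext_power m)"
    unfolding ext_power_zero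
    by (intro ext_class_in_carrier free.subspace_0[OF free_on_subspace])
next
  fix X assume X: "X \<in> carrier (ext_power m)"
  then obtain f where f: "f \<in> free_on (tuples m)" "X = ext_class m f" by (rule ext_power_cases)
  show "\<zero>\<^bsub>ext_power m\<^esub> \<oplus>\<^bsub>ext_power m\<^esub> X = X"
    unfolding f ext_power_zero ext_power_add by simp
  have "ext_class m (- f) \<oplus>\<^bsub>ext_power m\<^esub> X = \<zero>\<^bsub>ext_power m\<^esub>"
    unfolding f ext_power_zero ext_power_add by simp
  then show "\<exists>Y\<in>carrier (ext_power m). Y \<oplus>\<^bsub>ext_power m\<^esub> X = \<zero>\<^bsub>ext_power m\<^esub>"
    using ext_class_in_carrier[OF free.subspace_neg[OF free_on_subspace f(1)]] by blast
qed

lemma ext_power_module: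
  "Module.module \<lparr>carrier = UNIV, monoid.mult = (*), one = 1, zero = 0, add = (+)\<rparr> (ext_power m)"
proof (rule moduleI)
  let ?K = "\<lparr>carrier = UNIV :: 'k set, monoid.mult = (*), one = 1, zero = 0, add = (+)\<rparr>"
  show "cring ?K"
  proof (rule cringI)
    show "abelian_group ?K"
    proof (rule abelian_groupI)
      fix a assume "a \<in> carrier ?K"
      show "\<exists>b\<in>carrier ?K. b \<oplus>\<^bsub>?K\<^esub> a = \<zero>\<^bsub>?K\<^esub>" by (simp add: exI[of _ "- a"])
    qed (simp_all add: add.assoc add.commute)
    show "Group.comm_monoid ?K"
      by (rule comm_monoidI) (simp_all add: mult.assoc mult.commute)
  qed (simp add: distrib_right)
next
  fix c :: 'k and X assume "X \<in> carrier (ext_power m)"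
  then obtain f where f: "f \<in> free_on (tuples m)" "X = ext_class m f" by (rule ext_power_cases)
  show "c \<odot>\<^bsub>ext_power m\<^esub> X \<in> carrier (ext_power m)"
    unfolding f ext_power_smult
    by (intro ext_class_in_carrier free.subspace_scale[OF free_on_subspace] f)
qed (auto elim!: ext_power_cases simp: ext_power_add ext_power_smult free.scale_left_distrib
    free.scale_right_distrib ext_power_abelian_group)

lemma lin_ext_ext_rels:
  assumes "\<And>r. r \<in> ext_relators m \<Longrightarrow> lin_ext \<phi> r \<in> ext_rels m" "r \<in> ext_rels m"
  shows "lin_ext \<phi> r \<in> ext_rels m"
  using assms(2)[unfolded ext_rels_def]
proof (induction rule: free.span_induct_alt)
  case base
  then show ?case by (simp add: free.subspace_0[OF ext_rels_subspace])
next
  case (step c x y)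
  then show ?case
    by (simp add: lin_ext_add lin_ext_scale assms(1) free.subspace_add[OF ext_rels_subspace]
        free.subspace_scale[OF ext_rels_subspace])
qed

lemma ext_induced_class:
  assumes "\<And>r. r \<in> ext_relators m \<Longrightarrow> lin_ext \<phi> r \<in> ext_rels m"
  shows "ext_induced m \<phi> (ext_class m f) = ext_class m (lin_ext \<phi> f)"
  unfolding ext_induced_def
  using lin_ext_ext_rels[OF assms] by (intro ext_class_UN lin_ext_diff) blast+

lemma rel_add:
  "\<lbrakk>us @ v # ws \<in> tuples m; w \<in> V\<rbrakk> \<Longrightarrow>
    fvec (us @ (v + w) # ws) - fvec (us @ v # ws) - fvec (us @ w # ws) \<in> ext_rels m"
  unfolding ext_rels_def by (rule free.span_base) (unfold ext_relators_def, blast)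

lemma rel_scale:
  "us @ v # ws \<in> tuples m \<Longrightarrow>
    fvec (us @ scale c v # ws) - fscale c (fvec (us @ v # ws)) \<in> ext_rels m"
  unfolding ext_rels_def by (rule free.span_base) (unfold ext_relators_def, blast)

lemma rel_alt: "\<lbrakk>vs \<in> tuples m; \<not> distinct vs\<rbrakk> \<Longrightarrow> fvec vs \<in> ext_rels m"
  unfolding ext_rels_def by (rule free.span_base) (unfold ext_relators_def, blast)

lemma ext_relators_cases:
  assumes "r \<in> ext_relators m"
  obtains (add) us v w ws where "us @ v # ws \<in> tuples m" "w \<in> V"
      "r = fvec (us @ (v + w) # ws) - fvec (us @ v # ws) - fvec (us @ w # ws)"
  | (scale) us c v ws where "us @ v # ws \<in> tuples m"
      "r = fvec (us @ scale c v # ws) - fscale c (fvec (us @ v # ws))"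
  | (alt) vs where "vs \<in> tuples m" "\<not> distinct vs" "r = fvec vs"
  using assms unfolding ext_relators_def by blast

lemma tuples_map: "\<lbrakk>g \<in> carrier G; vs \<in> tuples m\<rbrakk> \<Longrightarrow> map (\<rho> g) vs \<in> tuples m"
  by (auto simp: tuples_def \<rho>_closed)

lemma list_update_in_V:
  "\<lbrakk>set us \<subseteq> V; g \<in> carrier G; p < length us\<rbrakk> \<Longrightarrow> set (us[p := \<rho> g (us ! p)]) \<subseteq> V"
  using set_update_subset_insert[of us p "\<rho> g (us ! p)"] \<rho>_closed[of g "us ! p"] nth_mem[of p us]
  by blast

lemma tuples_update: "\<lbrakk>w \<in> V; vs \<in> tuples m\<rbrakk> \<Longrightarrow> vs[p := w] \<in> tuples m"
  using set_update_subset_insert[of vs p w] by (auto simp: tuples_def)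

lemma A_relators:
  assumes g: "g \<in> carrier G" and "r \<in> ext_relators m"
  shows "lin_ext (\<lambda>vs. fvec (map (\<rho> g) vs)) r \<in> ext_rels m"
  using assms(2)
proof (cases rule: ext_relators_cases)
  case (add us v w ws)
  then have "v \<in> V" "map (\<rho> g) us @ \<rho> g v # map (\<rho> g) ws \<in> tuples m"
    using tuples_map[OF g add(1)] by (auto simp: tuples_def)
  then show ?thesis
    using rel_add[of "map (\<rho> g) us" "\<rho> g v" "map (\<rho> g) ws" m "\<rho> g w"] add g
    by (simp add: lin_ext_diff \<rho>_closed \<rho>_add)
next
  case (scale us c v ws)
  then have "v \<in> V" "map (\<rho> g) us @ \<rho> g v # map (\<rho> g) ws \<in> tuples m"
    using tuples_map[OF g scale(1)] by (auto simp: tuples_def)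
  then show ?thesis
    using rel_scale[of "map (\<rho> g) us" "\<rho> g v" "map (\<rho> g) ws" m c] scale g
    by (simp add: lin_ext_diff lin_ext_scale \<rho>_scale)
next
  case (alt vs)
  then show ?thesis
    using rel_alt[OF tuples_map[OF g alt(1)]] by (auto simp: distinct_map)
qed

text \<open>Swapping two entries of a wedge changes the sign.\<close>

lemma rel_swap:
  assumes "vs \<in> tuples m" "v \<in> V" "w \<in> V" "i < m" "j < m" "i \<noteq> j"
  shows "fvec (vs[i := v, j := w]) + fvec (vs[i := w, j := v]) \<in> ext_rels m"
proof -
  have len: "length vs = m" using assms(1) by (simp add: tuples_def)
  have lin: "fvec (us[p := a + b]) - fvec (us[p := a]) - fvec (us[p := b]) \<in> ext_rels m"
    if "us \<in> tuples m" "a \<in> V" "b \<in> V" "p < m" for us a b p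
  proof -
    have "us[p := c] = take p us @ c # drop (Suc p) us" for c
      using that by (simp add: upd_conv_take_nth_drop tuples_def)
    then show ?thesis
      using rel_add[of "take p us" a "drop (Suc p) us" m b] tuples_update[OF that(2,1), of p] that
      by metis
  qed
  have vw: "v + w \<in> V" using subspace_add[OF V_subspace] assms by blast
  have alt: "fvec (vs[i := a, j := a]) \<in> ext_rels m" if "a \<in> V" for a
  proof (rule rel_alt)
    show "vs[i := a, j := a] \<in> tuples m" by (intro tuples_update that assms)
    show "\<not> distinct (vs[i := a, j := a])"
    proof
      assume "distinct (vs[i := a, j := a])"
      then have "(vs[i := a, j := a]) ! i \<noteq> (vs[i := a, j := a]) ! j"
        using assms len by (subst nth_eq_iff_index_eq) auto
      then show False using assms len by (simp add: nth_list_update)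
    qed
  qed
  define L where "L a b = (fvec (vs[i := a, j := b]) :: 'v list \<Rightarrow>\<^sub>0 'k)" for a b
  have r: "L (v + w) b - L v b - L w b \<in> ext_rels m" if "b \<in> V" for b
    using lin[of "vs[j := b]" v w i] assms that
    by (simp add: L_def list_update_swap[of i j] tuples_update)
  have l: "L a (v + w) - L a v - L a w \<in> ext_rels m" if "a \<in> V" for a
    using lin[of "vs[i := a]" v w j] assms that by (simp add: L_def tuples_update)
  have "L (v + w) (v + w) - L v v - L w w
      - (L (v + w) (v + w) - L v (v + w) - L w (v + w))
      - (L v (v + w) - L v v - L v w) - (L w (v + w) - L w v - L w w) \<in> ext_rels m"
    using alt vw assms by (intro free.subspace_diff[OF ext_rels_subspace] r l) (auto simp: L_def)
  then show ?thesis by (simp add: L_def)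
qed

lemma B_relators:
  assumes g: "g \<in> carrier G" and "r \<in> ext_relators m"
  shows "lin_ext (\<lambda>vs. \<Sum>p<m. fvec (vs[p := \<rho> g (vs ! p)])) r \<in> ext_rels m"
  using assms(2)
proof (cases rule: ext_relators_cases)
  case (add us v w ws)
  have V: "v \<in> V" "set us \<subseteq> V" "set ws \<subseteq> V" "m = length us + Suc (length ws)"
    using add(1) by (auto simp: tuples_def)
  have "fvec ((us @ (v + w) # ws)[p := \<rho> g ((us @ (v + w) # ws) ! p)])
      - fvec ((us @ v # ws)[p := \<rho> g ((us @ v # ws) ! p)])
      - fvec ((us @ w # ws)[p := \<rho> g ((us @ w # ws) ! p)]) \<in> ext_rels m" if p: "p < m" for p
  proof -
    consider "p < length us" | "p = length us" | q where "p = length us + Suc q" "q < length ws"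
      using p V(4) less_imp_Suc_add[of "length us" p] by (metis add_Suc_right linorder_cases nat_add_left_cancel_less Suc_less_eq)
    then show ?thesis
    proof cases
      case 1
      with V add g show ?thesis
        using rel_add[of "us[p := \<rho> g (us ! p)]" v ws m w] list_update_in_V[of us g p]
        by (auto simp: nth_append list_update_append tuples_def)
    next
      case 2
      with V add g show ?thesis
        using rel_add[of us "\<rho> g v" ws m "\<rho> g w"]
        by (auto simp: tuples_def \<rho>_closed \<rho>_add)
    next
      case 3
      with V add g show ?thesis
        using rel_add[of us v "ws[q := \<rho> g (ws ! q)]" m w] list_update_in_V[of ws g q]
        by (auto simp: nth_append list_update_append tuples_def)
    qed
  qed
  then show ?thesis
    unfolding add(3) lin_ext_diff lin_ext_fvec sum_subtractf[symmetric]
    by (intro free.subspace_sum[OF ext_rels_subspace]) auto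
next
  case (scale us c v ws)
  have V: "v \<in> V" "set us \<subseteq> V" "set ws \<subseteq> V" "m = length us + Suc (length ws)"
    using scale(1) by (auto simp: tuples_def)
  have "fvec ((us @ scale c v # ws)[p := \<rho> g ((us @ scale c v # ws) ! p)])
      - fscale c (fvec ((us @ v # ws)[p := \<rho> g ((us @ v # ws) ! p)])) \<in> ext_rels m" if p: "p < m" for p
  proof -
    consider "p < length us" | "p = length us" | q where "p = length us + Suc q" "q < length ws"
      using p V(4) less_imp_Suc_add[of "length us" p] by (metis add_Suc_right linorder_cases nat_add_left_cancel_less Suc_less_eq)
    then show ?thesis
    proof cases
      case 1
      with V scale g show ?thesis
        using rel_scale[of "us[p := \<rho> g (us ! p)]" v ws m c] list_update_in_V[of us g p]
        by (auto simp: nth_append list_update_append tuples_def)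
    next
      case 2
      with V scale g show ?thesis
        using rel_scale[of us "\<rho> g v" ws m c]
        by (auto simp: tuples_def \<rho>_closed \<rho>_scale)
    next
      case 3
      with V scale g show ?thesis
        using rel_scale[of us v "ws[q := \<rho> g (ws ! q)]" m c] list_update_in_V[of ws g q]
        by (auto simp: nth_append list_update_append tuples_def)
    qed
  qed
  then show ?thesis
    unfolding scale(2) lin_ext_diff lin_ext_scale lin_ext_fvec free.scale_sum_right
      sum_subtractf[symmetric]
    by (intro free.subspace_sum[OF ext_rels_subspace]) auto
next
  case (alt vs)
  then obtain i j where ij: "i < m" "j < m" "i \<noteq> j" "vs ! i = vs ! j"
    by (auto simp: distinct_conv_nth tuples_def)
  have len: "length vs = m" and V: "set vs \<subseteq> V" using alt(1) by (auto simp: tuples_def)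
  let ?t = "\<lambda>p. fvec (vs[p := \<rho> g (vs ! p)]) :: 'v list \<Rightarrow>\<^sub>0 'k"
  have nV: "vs ! p \<in> V" if "p < m" for p using that len V by auto
  have rest: "?t p \<in> ext_rels m" if "p \<in> {..<m} - {i, j}" for p
  proof (rule rel_alt)
    show "vs[p := \<rho> g (vs ! p)] \<in> tuples m"
      using that nV by (auto intro!: tuples_update alt(1) \<rho>_closed g)
    show "\<not> distinct (vs[p := \<rho> g (vs ! p)])"
    proof
      assume "distinct (vs[p := \<rho> g (vs ! p)])"
      then have "(vs[p := \<rho> g (vs ! p)]) ! i \<noteq> (vs[p := \<rho> g (vs ! p)]) ! j"
        using ij len by (subst nth_eq_iff_index_eq) auto
      then show False using that ij len by (simp add: nth_list_update)
    qed
  qed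
  have "vs[i := \<rho> g (vs ! i)] = vs[i := \<rho> g (vs ! i), j := vs ! i]"
    using ij by (metis list_update_id list_update_swap)
  moreover have "vs[j := \<rho> g (vs ! j)] = vs[i := vs ! i, j := \<rho> g (vs ! i)]"
    using ij by (metis list_update_id)
  ultimately have "?t i + ?t j \<in> ext_rels m"
    using rel_swap[OF alt(1) _ _ ij(1-3), of "\<rho> g (vs ! i)" "vs ! i"] nV[OF ij(1)] \<rho>_closed[OF g]
    by simp
  moreover have "(\<Sum>p<m. ?t p) = (?t i + ?t j) + (\<Sum>p\<in>{..<m} - {i, j}. ?t p)"
    using ij sum.subset_diff[of "{i, j}" "{..<m}" ?t] by (simp add: add.commute)
  ultimately show ?thesis
    using free.subspace_add[OF ext_rels_subspace _ free.subspace_sum[OF ext_rels_subspace rest]]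
    by (simp only: alt(3) lin_ext_fvec)
qed

lemma A_op_class:
  "g \<in> carrier G \<Longrightarrow> A_op m g (ext_class m f) = ext_class m (lin_ext (\<lambda>vs. fvec (map (\<rho> g) vs)) f)"
  unfolding A_op_def by (intro ext_induced_class A_relators)

lemma B_op_class:
  "g \<in> carrier G \<Longrightarrow> B_op m g (ext_class m f) =
    ext_class m (lin_ext (\<lambda>vs. \<Sum>p<m. fvec (vs[p := \<rho> g (vs ! p)])) f)"
  unfolding B_op_def by (intro ext_induced_class B_relators)

lemma A_op_wedge:
  assumes "g \<in> carrier G" "vs \<in> tuples m"
  shows "A_op m g (wedge vs) = wedge (map (\<rho> g) vs)"
  using assms by (simp add: wedge_def A_op_class tuples_def)

lemma finsum_ext_class:
  assumes "finite S" "\<And>s. s \<in> S \<Longrightarrow> f s \<in> free_on (tuples m)"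
  shows "(\<Oplus>\<^bsub>ext_power m\<^esub>s\<in>S. ext_class m (f s)) = ext_class m (\<Sum>s\<in>S. f s)"
proof -
  interpret M: abelian_group "ext_power m" by (rule ext_power_abelian_group)
  show ?thesis using assms
  proof (induction S rule: finite_induct)
    case empty
    then show ?case by (simp add: ext_power_zero)
  next
    case (insert s S)
    then have "(\<lambda>s. ext_class m (f s)) \<in> S \<rightarrow> carrier (ext_power m)"
      "ext_class m (f s) \<in> carrier (ext_power m)"
      by (auto simp: ext_power_carrier)
    with insert show ?case by (simp add: M.finsum_insert ext_power_add)
  qed
qed

lemma B_op_wedge:
  assumes "g \<in> carrier G" "vs \<in> tuples m"
  shows "B_op m g (wedge vs) = (\<Oplus>\<^bsub>ext_power m\<^esub>p\<in>{..<m}. wedge (vs[p := \<rho> g (vs ! p)]))"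
proof -
  have "vs[p := \<rho> g (vs ! p)] \<in> tuples m" if "p < m" for p
    using assms that by (intro tuples_update \<rho>_closed) (auto simp: tuples_def)
  then have "(\<Oplus>\<^bsub>ext_power m\<^esub>p\<in>{..<m}. ext_class m (fvec (vs[p := \<rho> g (vs ! p)])))
      = ext_class m (\<Sum>p<m. fvec (vs[p := \<rho> g (vs ! p)]))"
    by (intro finsum_ext_class) (auto simp: fvec_in_free_on)
  then show ?thesis
    using assms by (simp add: wedge_def B_op_class tuples_def)
qed

lemma A_op_linear:
  assumes "g \<in> carrier G" "X \<in> carrier (ext_power m)" "Y \<in> carrier (ext_power m)"
  shows "A_op m g X \<in> carrier (ext_power m)"
    and "A_op m g (X \<oplus>\<^bsub>ext_power m\<^esub> Y) = A_op m g X \<oplus>\<^bsub>ext_power m\<^esub> A_op m g Y"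
    and "A_op m g (c \<odot>\<^bsub>ext_power m\<^esub> X) = c \<odot>\<^bsub>ext_power m\<^esub> A_op m g X"
  using assms
  by (auto simp: ext_power_carrier A_op_class ext_power_add ext_power_smult lin_ext_add
      lin_ext_scale fvec_in_free_on intro!: imageI lin_ext_in_free_on tuples_map)

lemma B_op_linear:
  assumes "g \<in> carrier G" "X \<in> carrier (ext_power m)" "Y \<in> carrier (ext_power m)"
  shows "B_op m g X \<in> carrier (ext_power m)"
    and "B_op m g (X \<oplus>\<^bsub>ext_power m\<^esub> Y) = B_op m g X \<oplus>\<^bsub>ext_power m\<^esub> B_op m g Y"
    and "B_op m g (c \<odot>\<^bsub>ext_power m\<^esub> X) = c \<odot>\<^bsub>ext_power m\<^esub> B_op m g X"
proof -
  obtain f h where f: "f \<in> free_on (tuples m)" "X = ext_class m f"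
    and h: "h \<in> free_on (tuples m)" "Y = ext_class m h"
    using assms by (auto simp: ext_power_carrier)
  have "(\<Sum>p<m. fvec (vs[p := \<rho> g (vs ! p)])) \<in> free_on (tuples m)" if "vs \<in> tuples m" for vs
    using that list_update_in_V[OF _ assms(1), of vs]
    by (intro free.subspace_sum[OF free_on_subspace]) (simp add: fvec_in_free_on tuples_def)
  then show "B_op m g X \<in> carrier (ext_power m)"
    unfolding f B_op_class[OF assms(1)]
    by (intro ext_class_in_carrier lin_ext_in_free_on[OF _ f(1)])
  show "B_op m g (X \<oplus>\<^bsub>ext_power m\<^esub> Y) = B_op m g X \<oplus>\<^bsub>ext_power m\<^esub> B_op m g Y"
    by (simp only: f h B_op_class[OF assms(1)] ext_power_add lin_ext_add)
  show "B_op m g (c \<odot>\<^bsub>ext_power m\<^esub> X) = c \<odot>\<^bsub>ext_power m\<^esub> B_op m g X"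
    by (simp only: f B_op_class[OF assms(1)] ext_power_smult lin_ext_scale)
qed

lemma ext_power_eq_span_wedges:
  assumes "f \<in> free_on (tuples m)"
  shows "ext_class m f = (\<Oplus>\<^bsub>ext_power m\<^esub>vs\<in>Poly_Mapping.keys f.
    Poly_Mapping.lookup f vs \<odot>\<^bsub>ext_power m\<^esub> wedge vs)"
proof -
  interpret M: abelian_group "ext_power m" by (rule ext_power_abelian_group)
  have t: "vs \<in> tuples m" if "vs \<in> Poly_Mapping.keys f" for vs
    using assms that by (auto simp: free_on_def)
  have c: "ext_class m (fscale (Poly_Mapping.lookup f vs) (fvec vs)) =
      Poly_Mapping.lookup f vs \<odot>\<^bsub>ext_power m\<^esub> wedge vs" if "vs \<in> Poly_Mapping.keys f" for vs
    using t[OF that] by (simp add: wedge_def ext_power_smult tuples_def)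
  have fr: "fscale (Poly_Mapping.lookup f vs) (fvec vs) \<in> free_on (tuples m)"
    if "vs \<in> Poly_Mapping.keys f" for vs
    using t[OF that] by (simp add: free.subspace_scale[OF free_on_subspace] fvec_in_free_on)
  have "ext_class m f = ext_class m (lin_ext fvec f)" by (simp add: lin_ext_self)
  also have "\<dots> = (\<Oplus>\<^bsub>ext_power m\<^esub>vs\<in>Poly_Mapping.keys f.
      ext_class m (fscale (Poly_Mapping.lookup f vs) (fvec vs)))"
    unfolding lin_ext_def using fr by (intro finsum_ext_class[symmetric]) auto
  also have "\<dots> = (\<Oplus>\<^bsub>ext_power m\<^esub>vs\<in>Poly_Mapping.keys f.
      Poly_Mapping.lookup f vs \<odot>\<^bsub>ext_power m\<^esub> wedge vs)"
    using c fr by (intro M.finsum_cong') (auto simp: ext_power_carrier simp flip: c)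
  finally show ?thesis .
qed

end


section \<open>The permutation representation of the symmetric group\<close>

definition Cn :: "nat \<Rightarrow> (nat \<Rightarrow>\<^sub>0 complex) set"
  where "Cn n = free_on {1..n}"

definition perm_act :: "(nat \<Rightarrow> nat) \<Rightarrow> (nat \<Rightarrow>\<^sub>0 complex) \<Rightarrow> (nat \<Rightarrow>\<^sub>0 complex)"
  where "perm_act \<sigma> = lin_ext (\<lambda>i. fvec (\<sigma> i))"

lemma Cn_eq_span: "Cn n = free.span (fvec ` {1..n})"
proof (intro equalityI subsetI)
  fix f assume "f \<in> Cn n"
  then have "Poly_Mapping.keys f \<subseteq> {1..n}" by (simp only: Cn_def free_on_def mem_Collect_eq)
  then have "lin_ext fvec f \<in> free.span (fvec ` {1..n})"
    unfolding lin_ext_def by (intro free.span_sum free.span_scale free.span_base imageI) (rule subsetD)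
  then show "f \<in> free.span (fvec ` {1..n})" by (simp only: lin_ext_self)
next
  have "(fvec ` {1..n} :: (nat \<Rightarrow>\<^sub>0 complex) set) \<subseteq> Cn n"
    unfolding Cn_def by (intro image_subsetI) (simp only: fvec_in_free_on)
  then have "free.span (fvec ` {1..n} :: (nat \<Rightarrow>\<^sub>0 complex) set) \<subseteq> Cn n"
    by (rule free.span_minimal) (simp only: Cn_def free_on_subspace)
  then show "f \<in> Cn n" if "f \<in> free.span (fvec ` {1..n})" for f
    using that by (rule subsetD)
qed

lemma dim_Cn: "free.dim (Cn n) = n"
proof -
  have inj: "inj_on (fvec :: nat \<Rightarrow> (nat \<Rightarrow>\<^sub>0 complex)) {1..n}"
  proof (rule inj_onI)
    fix i j assume "(fvec i :: nat \<Rightarrow>\<^sub>0 complex) = fvec j"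
    then have "Poly_Mapping.keys (fvec i :: nat \<Rightarrow>\<^sub>0 complex) = Poly_Mapping.keys (fvec j :: nat \<Rightarrow>\<^sub>0 complex)"
      by simp
    then show "i = j" by simp
  qed
  have "free.independent ((fvec :: nat \<Rightarrow> (nat \<Rightarrow>\<^sub>0 complex)) ` {1..n})"
  proof (rule free.independent_if_scalars_zero)
    fix u :: "(nat \<Rightarrow>\<^sub>0 complex) \<Rightarrow> complex" and x :: "nat \<Rightarrow>\<^sub>0 complex"
    assume s: "(\<Sum>x\<in>fvec ` {1..n}. fscale (u x) x) = 0" and "x \<in> fvec ` {1..n}"
    then obtain i where i: "x = fvec i" "i \<in> {1..n}" by auto
    have "0 = Poly_Mapping.lookup (\<Sum>j\<in>{1..n}. fscale (u (fvec j)) (fvec j)) i"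
      using s unfolding sum.reindex[OF inj] o_def by simp
    also have "\<dots> = (\<Sum>j\<in>{1..n}. if i = j then u (fvec j) else 0)"
      unfolding lookup_sum by (rule sum.cong[OF refl]) (simp add: lookup_single when_def)
    also have "\<dots> = u x"
      using i by (simp add: sum.delta')
    finally show "u x = 0" by simp
  qed auto
  then have "free.dim (Cn n) = card ((fvec :: nat \<Rightarrow> (nat \<Rightarrow>\<^sub>0 complex)) ` {1..n})"
    unfolding Cn_eq_span by (rule free.dim_span_eq_card_independent)
  also have "\<dots> = n" unfolding card_image[OF inj] by simp
  finally show ?thesis .
qed

interpretation perm: fd_representation fscale "sym_group n" "Cn n" perm_act for n
proof (intro fd_representation.intro fd_representation_axioms.intro)
  show "vector_space (fscale :: complex \<Rightarrow> (nat \<Rightarrow>\<^sub>0 complex) \<Rightarrow> _)"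
    by (rule free.vector_space_axioms)
  show "group (sym_group n)" by (rule sym_group_is_group)
  show "free.subspace (Cn n)" by (simp add: Cn_def free_on_subspace)
  show "\<exists>B. finite B \<and> free.span B = Cn n"
    by (intro exI[of _ "fvec ` {1..n}"]) (simp add: Cn_eq_span)
  show "perm_act \<sigma> v \<in> Cn n" if "\<sigma> \<in> carrier (sym_group n)" "v \<in> Cn n" for \<sigma> v
    using that unfolding perm_act_def Cn_def sym_group_carrier
    by (intro lin_ext_in_free_on[of "{1..n}"]) (auto simp: free_on_def permutes_in_image simp del: atLeastAtMost_iff)
  show "perm_act \<sigma> (fscale c v) = fscale c (perm_act \<sigma> v)" for \<sigma> c v
    by (simp add: perm_act_def lin_ext_scale)
  show "perm_act \<sigma> (v + w) = perm_act \<sigma> v + perm_act \<sigma> w" for \<sigma> v w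
    by (simp add: perm_act_def lin_ext_add)
  show "perm_act \<one>\<^bsub>sym_group n\<^esub> v = v" for v
    by (simp add: perm_act_def sym_group_one lin_ext_self)
  show "perm_act (\<sigma> \<otimes>\<^bsub>sym_group n\<^esub> \<tau>) v = perm_act \<sigma> (perm_act \<tau> v)" for \<sigma> \<tau> v
    unfolding perm_act_def sym_group_mult monoid.simps lin_ext_def[of _ v]
    by (simp add: lin_ext_sum lin_ext_scale)
qed

definition Lie_Sn :: "nat \<Rightarrow> ((nat \<Rightarrow> nat) \<Rightarrow>\<^sub>0 complex) set"
  where "Lie_Sn n = fd_representation.lie_elements fscale (sym_group n) (Cn n) perm_act"

definition std_embed :: "nat \<Rightarrow> (nat \<Rightarrow> nat) \<Rightarrow> (nat \<Rightarrow> nat)"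
  where "std_embed n \<sigma> = (\<lambda>k. if k \<in> {1..n} then \<sigma> k else k)"

definition std_embed_alg ::
  "nat \<Rightarrow> ((nat \<Rightarrow> nat) \<Rightarrow>\<^sub>0 complex) \<Rightarrow> ((nat \<Rightarrow> nat) \<Rightarrow>\<^sub>0 complex)"
  where "std_embed_alg n = lin_ext (\<lambda>\<sigma>. fvec (std_embed n \<sigma>))"

text \<open>
  Permutations of \<open>{1..n}\<close> are represented by functions that fix all numbers outside of \<open>{1..n}\<close>, so
  the embedding does not change the underlying function.
\<close>

lemma std_embed_eq: "\<sigma> \<in> carrier (sym_group n) \<Longrightarrow> std_embed n \<sigma> = \<sigma>"
  by (auto simp: std_embed_def sym_group_carrier permutes_def)

lemma std_embed_hom: "std_embed n \<in> hom (sym_group n) (sym_group (Suc n))"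
proof (rule homI)
  show "std_embed n \<sigma> \<in> carrier (sym_group (Suc n))" if "\<sigma> \<in> carrier (sym_group n)" for \<sigma>
    using that std_embed_eq[OF that] permutes_subset[of \<sigma> "{1..n}" "{1..Suc n}"]
    by (simp add: sym_group_carrier)
  show "std_embed n (\<sigma> \<otimes>\<^bsub>sym_group n\<^esub> \<tau>) =
      std_embed n \<sigma> \<otimes>\<^bsub>sym_group (Suc n)\<^esub> std_embed n \<tau>"
    if "\<sigma> \<in> carrier (sym_group n)" "\<tau> \<in> carrier (sym_group n)" for \<sigma> \<tau>
    using std_embed_eq that permutes_compose[of \<tau> "{1..n}" \<sigma>]
    by (simp add: sym_group_carrier sym_group_mult)
qed

end

theory Submission
  imports Defs
begin

text \<open>
  Put \<open>e = x\<^bsub>n+1\<^esub>\<close>, which is fixed by \<open>S\<^sub>n\<close>. The condition \<open>A\<^sub>m(x) = B\<^sub>m(x)\<close> need only be checked on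
  wedges of distinct basis vectors. On a wedge without \<open>e\<close> it is the condition for \<open>\<complex>\<^sup>n\<close>. On a wedge
  obtained from \<open>w\<close> by inserting \<open>e\<close> at some position, \<open>A\<^sub>m(x)\<close> acts as \<open>A\<^bsub>m-1\<^esub>(x)\<close> on \<open>w\<close>, and \<open>B\<^sub>m(x)\<close>
  as \<open>B\<^bsub>m-1\<^esub>(x)\<close> on \<open>w\<close> plus multiplication by the sum of the coefficients of \<open>x\<close>. That sum
  vanishes for a Lie element by the condition \<open>A\<^sub>0(x) = B\<^sub>0(x)\<close>.
\<close>

section \<open>Linear extensions, sums and insertion into lists\<close>

lemma lin_ext_sum_scale_fun:
  "lin_ext (\<lambda>a. \<Sum>s\<in>S. fscale (c s) (\<phi> s a)) f = (\<Sum>s\<in>S. fscale (c s) (lin_ext (\<phi> s) f))"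
  unfolding lin_ext_def free.scale_sum_right
  by (subst sum.swap) (simp only: free.scale_left_commute)

lemma lin_ext_diff_fun: "lin_ext (\<lambda>a. \<phi> a - \<psi> a) f = lin_ext \<phi> f - lin_ext \<psi> f"
  by (simp add: lin_ext_def free.scale_right_diff_distrib sum_subtractf)

text \<open>The index \<open>if p < k then p else Suc p\<close> runs through the indices up to
  \<open>m\<close> other than \<open>k\<close> in increasing order. It splits off the summand of
  \<open>B\<close> at the position of the fixed vector.\<close>

lemma sum_lessThan_Suc_remove:
  fixes h :: "nat \<Rightarrow> 'a::comm_monoid_add"
  shows "k \<le> m \<Longrightarrow> (\<Sum>p<Suc m. h p) = h k + (\<Sum>p<m. h (if p < k then p else Suc p))"
proof (induction m)
  case (Suc m)
  show ?case
  proof (cases "k = Suc m")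
    case True
    then show ?thesis by (simp add: add.commute)
  next
    case False
    with Suc show ?thesis by (simp add: add.assoc)
  qed
qed simp

text \<open>An arbitrary position is allowed so that a fixed vector inside a wedge can stay where it
  is, without signs from moving it to the front.\<close>

definition insert_at :: "nat \<Rightarrow> 'a \<Rightarrow> 'a list \<Rightarrow> 'a list"
  where "insert_at k a xs = take k xs @ a # drop k xs"

lemma length_insert_at [simp]: "length (insert_at k a xs) = Suc (length xs)"
  by (simp add: insert_at_def)

lemma set_insert_at [simp]: "set (insert_at k a xs) = insert a (set xs)"
  using set_append[of "take k xs" "drop k xs"] unfolding append_take_drop_id
  by (auto simp: insert_at_def)

lemma map_insert_at: "map f (insert_at k a xs) = insert_at k (f a) (map f xs)"
  by (simp add: insert_at_def take_map drop_map)

lemma distinct_insert_atD: "distinct (insert_at k a xs) \<Longrightarrow> distinct xs"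
  using distinct_append[of "take k xs" "drop k xs"] by (simp add: insert_at_def)

text \<open>The lists \<open>us'\<close> and \<open>ws'\<close> do not depend on \<open>v\<close>.
  Hence insertion preserves the shape of relations that vary a single slot.\<close>

lemma insert_at_append_Cons:
  obtains us' ws' where "\<And>v. insert_at k a (us @ v # ws) = us' @ v # ws'"
proof (cases "k \<le> length us")
  case True
  then show ?thesis by (intro that[of "insert_at k a us" ws]) (simp add: insert_at_def)
next
  case False
  \<comment> \<open>The entry \<open>v\<close> itself occupies index \<open>length us\<close>, which
    accounts for the \<open>Suc\<close>: the insertion takes place at position \<open>j\<close> of
    \<open>ws\<close>.\<close>
  then obtain j where "k = length us + Suc j" by (metis less_imp_Suc_add not_le add_Suc_right)
  then show ?thesis by (intro that[of us "insert_at j a ws"]) (simp add: insert_at_def)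
qed

lemma insert_at_nth: "k \<le> length xs \<Longrightarrow> insert_at k a xs ! k = a"
  by (simp add: insert_at_def nth_append)

lemma insert_at_update_same: "k \<le> length xs \<Longrightarrow> (insert_at k a xs)[k := b] = insert_at k b xs"
  by (simp add: insert_at_def list_update_append)

lemma insert_at_update:
  assumes "k \<le> length xs" "p < length xs"
  shows "(insert_at k a xs)[(if p < k then p else Suc p) :=
      f (insert_at k a xs ! (if p < k then p else Suc p))] = insert_at k a (xs[p := f (xs ! p)])"
proof (cases "p < k")
  case True
  with assms show ?thesis
    by (simp add: insert_at_def nth_append list_update_append take_update_swap)
next
  case False
  with assms have "Suc p - k = Suc (p - k)" by simp
  with False assms show ?thesis
    by (simp add: insert_at_def nth_append list_update_append drop_update_swap)
qed

text \<open>Applying \<open>f\<close> at position \<open>k\<close> changes nothing because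
  \<open>f e = e\<close>, so that summand is the unchanged list; the other summands alter an entry
  of \<open>vs\<close>.\<close>

lemma sum_update_insert_at:
  assumes "length vs = m" "k \<le> m" "f e = e"
  shows "(\<Sum>p<Suc m. F ((insert_at k e vs)[p := f (insert_at k e vs ! p)])) =
    F (insert_at k e vs) + (\<Sum>p<m. F (insert_at k e (vs[p := f (vs ! p)])) :: 'a::comm_monoid_add)"
  unfolding sum_lessThan_Suc_remove[OF assms(2)] using assms
  by (intro arg_cong2[of _ _ _ _ "(+)"] sum.cong)
     (simp_all add: insert_at_nth insert_at_update_same insert_at_update del: if_split)

section \<open>Lie elements in a general representation\<close>

context fd_representation
begin

text \<open>A representative in the free space of \<open>A_alg m x - B_alg m x\<close> on the wedge
  of \<open>vs\<close>. Equality of the operators becomes membership in \<open>ext_rels m\<close>,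
  which avoids arithmetic with cosets.\<close>

definition lie_defect :: "nat \<Rightarrow> ('g \<Rightarrow>\<^sub>0 'k) \<Rightarrow> 'v list \<Rightarrow> ('v list \<Rightarrow>\<^sub>0 'k)"
  where "lie_defect m x vs = (\<Sum>g\<in>Poly_Mapping.keys x. fscale (Poly_Mapping.lookup x g)
    (fvec (map (\<rho> g) vs) - (\<Sum>p<m. fvec (vs[p := \<rho> g (vs ! p)]))))"

lemma lin_ext_lie_defect:
  "lin_ext (lie_defect m x) f = (\<Sum>g\<in>Poly_Mapping.keys x. fscale (Poly_Mapping.lookup x g)
    (lin_ext (\<lambda>vs. fvec (map (\<rho> g) vs)) f - lin_ext (\<lambda>vs. \<Sum>p<m. fvec (vs[p := \<rho> g (vs ! p)])) f))"
proof -
  have "lie_defect m x = (\<lambda>vs. \<Sum>g\<in>Poly_Mapping.keys x. fscale (Poly_Mapping.lookup x g)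
    (fvec (map (\<rho> g) vs) - (\<Sum>p<m. fvec (vs[p := \<rho> g (vs ! p)]))))"
    by (rule ext) (rule lie_defect_def)
  then show ?thesis
    by (simp only: lin_ext_sum_scale_fun lin_ext_diff_fun)
qed

text \<open>The defect is a linear combination of the maps that induce \<open>A_op\<close> and
  \<open>B_op\<close>, and these already respect the relations.\<close>

lemma lie_defect_relators:
  assumes "x \<in> free_on (carrier G)" "r \<in> ext_relators m"
  shows "lin_ext (lie_defect m x) r \<in> ext_rels m"
  unfolding lin_ext_lie_defect using assms
  by (intro free.subspace_sum[OF ext_rels_subspace] free.subspace_scale[OF ext_rels_subspace]
      free.subspace_diff[OF ext_rels_subspace] A_relators B_relators) (auto simp: free_on_def)

text \<open>Each side is the class of an explicit sum in the free space, and the difference of the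
  two sums is the linear extension of the defect.\<close>

lemma A_alg_eq_B_alg_iff:
  assumes x: "x \<in> free_on (carrier G)" and f: "f \<in> free_on (tuples m)"
  shows "A_alg m x (ext_class m f) = B_alg m x (ext_class m f) \<longleftrightarrow>
    lin_ext (lie_defect m x) f \<in> ext_rels m"
proof -
  interpret M: abelian_group "ext_power m" by (rule ext_power_abelian_group)
  have g: "g \<in> carrier G" if "g \<in> Poly_Mapping.keys x" for g
    using x that by (auto simp: free_on_def)
  let ?a = "\<lambda>g. fscale (Poly_Mapping.lookup x g) (lin_ext (\<lambda>vs. fvec (map (\<rho> g) vs)) f)"
  let ?b = "\<lambda>g. fscale (Poly_Mapping.lookup x g)
      (lin_ext (\<lambda>vs. \<Sum>p<m. fvec (vs[p := \<rho> g (vs ! p)])) f)"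
  have a: "?a g \<in> free_on (tuples m)" if "g \<in> Poly_Mapping.keys x" for g
    using f g[OF that]
    by (intro free.subspace_scale[OF free_on_subspace] lin_ext_in_free_on[OF _ f])
       (simp add: fvec_in_free_on tuples_map)
  have "(\<Sum>p<m. fvec (vs[p := \<rho> g (vs ! p)])) \<in> free_on (tuples m)"
    if "vs \<in> tuples m" "g \<in> Poly_Mapping.keys x" for vs g
    using that(1) list_update_in_V[OF _ g[OF that(2)], of vs]
    by (intro free.subspace_sum[OF free_on_subspace]) (simp add: fvec_in_free_on tuples_def)
  then have b: "?b g \<in> free_on (tuples m)" if "g \<in> Poly_Mapping.keys x" for g
    using that by (intro free.subspace_scale[OF free_on_subspace] lin_ext_in_free_on[OF _ f])
  have "A_alg m x (ext_class m f) = (\<Oplus>\<^bsub>ext_power m\<^esub>g\<in>Poly_Mapping.keys x. ext_class m (?a g))"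
    unfolding A_alg_def using a g
    by (intro M.finsum_cong') (auto simp: A_op_class ext_power_smult ext_power_carrier)
  also have "\<dots> = ext_class m (\<Sum>g\<in>Poly_Mapping.keys x. ?a g)"
    using a by (intro finsum_ext_class) auto
  finally have A: "A_alg m x (ext_class m f) = \<dots>" .
  have "B_alg m x (ext_class m f) = (\<Oplus>\<^bsub>ext_power m\<^esub>g\<in>Poly_Mapping.keys x. ext_class m (?b g))"
    unfolding B_alg_def using b g
    by (intro M.finsum_cong') (auto simp: B_op_class ext_power_smult ext_power_carrier)
  also have "\<dots> = ext_class m (\<Sum>g\<in>Poly_Mapping.keys x. ?b g)"
    using b by (intro finsum_ext_class) auto
  finally have B: "B_alg m x (ext_class m f) = \<dots>" .
  show ?thesis
    unfolding A B ext_class_eq_iff lin_ext_lie_defect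
    by (simp only: free.scale_right_diff_distrib sum_subtractf)
qed

lemma lie_elements_iff:
  "x \<in> lie_elements \<longleftrightarrow> x \<in> free_on (carrier G) \<and>
    (\<forall>m\<le>dim V. \<forall>vs\<in>tuples m. lie_defect m x vs \<in> ext_rels m)"
proof -
  have "(\<forall>X\<in>carrier (ext_power m). A_alg m x X = B_alg m x X) \<longleftrightarrow>
      (\<forall>vs\<in>tuples m. lie_defect m x vs \<in> ext_rels m)" if x: "x \<in> free_on (carrier G)" for m
  proof -
    have "(\<forall>X\<in>carrier (ext_power m). A_alg m x X = B_alg m x X) \<longleftrightarrow>
        (\<forall>f\<in>free_on (tuples m). lin_ext (lie_defect m x) f \<in> ext_rels m)"
      using A_alg_eq_B_alg_iff[OF x] by (simp add: ext_power_carrier)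
    also have "\<dots> \<longleftrightarrow> (\<forall>vs\<in>tuples m. lie_defect m x vs \<in> ext_rels m)"
    proof safe
      fix vs assume f: "\<forall>f\<in>free_on (tuples m). lin_ext (lie_defect m x) f \<in> ext_rels m"
        and "vs \<in> tuples m"
      then have "fvec vs \<in> free_on (tuples m)" by (simp only: fvec_in_free_on)
      with f have "lin_ext (lie_defect m x) (fvec vs) \<in> ext_rels m" by (rule bspec)
      then show "lie_defect m x vs \<in> ext_rels m" by (simp only: lin_ext_fvec)
    next
      fix f :: "'v list \<Rightarrow>\<^sub>0 'k"
      assume "\<forall>vs\<in>tuples m. lie_defect m x vs \<in> ext_rels m" "f \<in> free_on (tuples m)"
      then show "lin_ext (lie_defect m x) f \<in> ext_rels m"
        unfolding lin_ext_def
        by (intro free.subspace_sum[OF ext_rels_subspace] free.subspace_scale[OF ext_rels_subspace])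
           (auto simp: free_on_def)
    qed
    finally show ?thesis .
  qed
  then show ?thesis
    unfolding lie_elements_def by (simp add: atLeast0AtMost Ball_def cong: conj_cong)
qed

text \<open>Modulo the relations \<open>\<phi>\<close> is multilinear and kills tuples with a
  repeated entry. The entries can therefore be expanded in \<open>B\<close> one at a time; in the
  induction \<open>us\<close> is the part already restricted to \<open>B\<close>.\<close>

lemma basis_tuples_suffice:
  assumes \<phi>: "\<And>r. r \<in> ext_relators m \<Longrightarrow> lin_ext \<phi> r \<in> ext_rels m"
    and B: "span B = V"
    and basis: "\<And>us. \<lbrakk>length us = m; set us \<subseteq> B; distinct us\<rbrakk> \<Longrightarrow> \<phi> us \<in> ext_rels m"
    and vs: "vs \<in> tuples m"
  shows "\<phi> vs \<in> ext_rels m"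
proof -
  have BV: "B \<subseteq> V" using B span_superset by blast
  have rels: "lin_ext \<phi> r \<in> ext_rels m" if "r \<in> ext_rels m" for r
    using \<phi> that by (rule lin_ext_ext_rels)
  have "\<phi> (us @ ws) \<in> ext_rels m"
    if "set us \<subseteq> B" "set ws \<subseteq> V" "length us + length ws = m" for us ws
    using that
  proof (induction ws arbitrary: us)
    case Nil
    show ?case
    proof (cases "distinct us")
      case True
      with Nil show ?thesis by (simp add: basis)
    next
      \<comment> \<open>A repeated entry makes \<open>fvec us\<close> itself a relation, so its
        image under \<open>lin_ext \<phi>\<close> is one.\<close>
      case False
      with Nil BV have "fvec us \<in> ext_rels m"
        by (intro rel_alt) (auto simp: tuples_def)
      from rels[OF this] show ?thesis by simp
    qed
  next
    case (Cons v ws)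
    have tup: "us @ w # ws \<in> tuples m" if "w \<in> V" for w
      using that Cons.prems BV by (auto simp: tuples_def)
    \<comment> \<open>The vectors that may fill the current slot. They form a subspace containing
      \<open>B\<close>, hence include all of \<open>V\<close>.\<close>
    let ?S = "{w \<in> V. \<phi> (us @ w # ws) \<in> ext_rels m}"
    have scale: "\<phi> (us @ scale c w # ws) \<in> ext_rels m" if "w \<in> ?S" for c w
    proof -
      have "\<phi> (us @ scale c w # ws) - fscale c (\<phi> (us @ w # ws)) \<in> ext_rels m"
        using rels[OF rel_scale[OF tup, of w c]] that by (simp add: lin_ext_diff lin_ext_scale)
      moreover have "fscale c (\<phi> (us @ w # ws)) \<in> ext_rels m"
        using that by (simp add: free.subspace_scale[OF ext_rels_subspace])
      ultimately show ?thesis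
        using free.subspace_add[OF ext_rels_subspace] by fastforce
    qed
    have B_in: "w \<in> ?S" if "w \<in> B" for w
      using Cons.IH[of "us @ [w]"] Cons.prems that BV by auto
    have "subspace ?S"
    proof (rule subspaceI)
      have "\<phi> (us @ 0 # ws) \<in> ext_rels m"
      proof -
        \<comment> \<open>Writing the zero vector as \<open>scale 0 0\<close> makes the scaling
          relation applicable.\<close>
        have "\<phi> (us @ scale 0 0 # ws) - fscale 0 (\<phi> (us @ 0 # ws)) \<in> ext_rels m"
          using rels[OF rel_scale[OF tup, of 0 0]] subspace_0[OF V_subspace]
          by (simp add: lin_ext_diff lin_ext_scale)
        then show ?thesis by simp
      qed
      then show "0 \<in> ?S" using subspace_0[OF V_subspace] by simp
    next
      fix w w' assume w: "w \<in> ?S" "w' \<in> ?S"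
      then have "\<phi> (us @ (w + w') # ws) - \<phi> (us @ w # ws) - \<phi> (us @ w' # ws) \<in> ext_rels m"
        using rels[OF rel_add[OF tup, of w w']] by (simp add: lin_ext_diff)
      then have "\<phi> (us @ (w + w') # ws) - \<phi> (us @ w # ws) - \<phi> (us @ w' # ws)
          + (\<phi> (us @ w # ws) + \<phi> (us @ w' # ws)) \<in> ext_rels m"
        using w by (intro free.subspace_add[OF ext_rels_subspace]) auto
      then show "w + w' \<in> ?S"
        using w subspace_add[OF V_subspace] by simp
    next
      fix c w assume "w \<in> ?S"
      with scale[OF this] show "scale c w \<in> ?S"
        using subspace_scale[OF V_subspace] by simp
    qed
    then have "span B \<subseteq> ?S"
      using B_in by (intro span_minimal) auto
    then show ?case using Cons.prems B by auto
  qed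
  from this[of "[]" vs] vs show ?thesis by (simp add: tuples_def)
qed

text \<open>Applying \<open>g\<close> to all entries commutes with inserting the fixed vector, while
  the sum over positions gains one unchanged tuple for each \<open>g\<close>; these add up to the
  correction term. The identity holds in the free space, before passing to the quotient.\<close>

lemma lie_defect_insert_at:
  assumes "length vs = m" "k \<le> m" and e: "\<And>g. g \<in> Poly_Mapping.keys x \<Longrightarrow> \<rho> g e = e"
  shows "lie_defect (Suc m) x (insert_at k e vs) =
    lin_ext (\<lambda>us. fvec (insert_at k e us)) (lie_defect m x vs) -
    fscale (\<Sum>g\<in>Poly_Mapping.keys x. Poly_Mapping.lookup x g) (fvec (insert_at k e vs))"
proof -
  let ?I = "insert_at k e"
  have "(fvec (map (\<rho> g) (?I vs)) :: 'v list \<Rightarrow>\<^sub>0 'k) - (\<Sum>p<Suc m. fvec ((?I vs)[p := \<rho> g (?I vs ! p)])) =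
      lin_ext (\<lambda>us. fvec (?I us))
        (fvec (map (\<rho> g) vs) - (\<Sum>p<m. fvec (vs[p := \<rho> g (vs ! p)]))) - fvec (?I vs)"
    if "g \<in> Poly_Mapping.keys x" for g
    unfolding sum_update_insert_at[OF assms(1,2), of "\<rho> g" e fvec, OF e[OF that]] map_insert_at e[OF that]
      lin_ext_diff lin_ext_sum lin_ext_fvec by simp
  then show ?thesis
    unfolding lie_defect_def lin_ext_sum lin_ext_scale free.scale_sum_left sum_subtractf[symmetric]
      free.scale_right_diff_distrib[symmetric]
    by (intro sum.cong[OF refl]) (simp only:)
qed

text \<open>This is the condition for \<open>m = 0\<close>, where \<open>A\<^sub>0(g) = 1\<close> and \<open>B\<^sub>0(g) = 0\<close>.\<close>

lemma lie_elements_sum_coeffs: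
  assumes "x \<in> lie_elements"
  shows "(\<Sum>g\<in>Poly_Mapping.keys x. Poly_Mapping.lookup x g) = 0"
proof -
  have "lie_defect 0 x [] \<in> ext_rels 0"
    using assms by (auto simp: lie_elements_iff tuples_def)
  then have "fscale (\<Sum>g\<in>Poly_Mapping.keys x. Poly_Mapping.lookup x g) (fvec ([] :: 'v list)) = 0"
    by (simp add: ext_rels_0 lie_defect_def free.scale_sum_left)
  then have "(\<Sum>g\<in>Poly_Mapping.keys x. Poly_Mapping.lookup x g) *
      Poly_Mapping.lookup (fvec ([] :: 'v list) :: 'v list \<Rightarrow>\<^sub>0 'k) [] = 0"
    by (metis lookup_fscale lookup_zero)
  then show ?thesis by simp
qed

end

section \<open>From \<open>n\<close> to \<open>n + 1\<close> in the symmetric groups\<close>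

lemma Cn_Suc_mono: "Cn n \<subseteq> Cn (Suc n)"
  by (auto simp: Cn_def free_on_def)

text \<open>Permutations are functions that fix everything outside \<open>{1..n}\<close>, so the
  embedding leaves them unchanged and the theorem becomes an inclusion of \<open>Lie_Sn n\<close> in
  \<open>Lie_Sn (Suc n)\<close>.\<close>

lemma std_embed_alg_eq:
  assumes "x \<in> free_on (carrier (sym_group n))"
  shows "std_embed_alg n x = x"
proof -
  have "std_embed_alg n x = lin_ext fvec x"
    unfolding std_embed_alg_def lin_ext_def using assms
    by (intro sum.cong[OF refl]) (auto simp: free_on_def std_embed_eq)
  then show ?thesis by (simp only: lin_ext_self)
qed

lemma ext_rels_Suc_mono: "perm.ext_rels n m \<subseteq> perm.ext_rels (Suc n) m"
proof -
  have "perm.ext_relators n m \<subseteq> perm.ext_relators (Suc n) m"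
    using Cn_Suc_mono[of n] unfolding perm.ext_relators_def perm.tuples_def by blast
  then show ?thesis unfolding perm.ext_rels_def by (rule free.span_mono)
qed

text \<open>Inserting \<open>e\<close> at position \<open>k\<close> sends each relator to a relator
  of the same kind, so it induces a map from the \<open>m\<close>-th to the \<open>Suc m\<close>-th
  exterior power.\<close>

lemma ext_rels_insert_at:
  assumes e: "e \<in> Cn (Suc n)" and r: "r \<in> perm.ext_rels n m"
  shows "lin_ext (\<lambda>us. fvec (insert_at k e us)) r \<in> perm.ext_rels (Suc n) (Suc m)"
proof -
  have tup: "insert_at k e us \<in> perm.tuples (Suc n) (Suc m)" if "us \<in> perm.tuples n m" for us
    using that e Cn_Suc_mono[of n] unfolding perm.tuples_def by auto
  have relators: "lin_ext (\<lambda>us. fvec (insert_at k e us)) s \<in> perm.ext_rels (Suc n) (Suc m)"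
    if "s \<in> perm.ext_relators n m" for s
    using that
  proof (cases rule: perm.ext_relators_cases)
    case (add us v w ws)
    obtain us' ws' where i: "insert_at k e (us @ u # ws) = us' @ u # ws'" for u
      by (rule insert_at_append_Cons[of k e us ws]) blast
    show ?thesis
      unfolding add(3) lin_ext_diff lin_ext_fvec i
      using tup[OF add(1)] add(2) Cn_Suc_mono[of n] by (intro perm.rel_add) (auto simp: i)
  next
    case (scale us c v ws)
    obtain us' ws' where i: "insert_at k e (us @ u # ws) = us' @ u # ws'" for u
      by (rule insert_at_append_Cons[of k e us ws]) blast
    show ?thesis
      unfolding scale(2) lin_ext_diff lin_ext_scale lin_ext_fvec i
      using tup[OF scale(1)] by (intro perm.rel_scale) (auto simp: i)
  next
    case (alt us)
    then show ?thesis
      unfolding alt(3) lin_ext_fvec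
      using distinct_insert_atD[of k e us] by (intro perm.rel_alt tup) auto
  qed
  show ?thesis
    using r unfolding perm.ext_rels_def[of n]
  proof (induction rule: free.span_induct_alt)
    case base
    then show ?case by (simp add: free.subspace_0[OF perm.ext_rels_subspace])
  next
    case (step c s t)
    then show ?case
      unfolding lin_ext_add lin_ext_scale
      by (intro free.subspace_add[OF perm.ext_rels_subspace]
          free.subspace_scale[OF perm.ext_rels_subspace] relators step)
  qed
qed

lemma Lie_Sn_Suc:
  assumes "x \<in> Lie_Sn n"
  shows "x \<in> Lie_Sn (Suc n)"
proof -
  let ?e = "fvec (Suc n) :: nat \<Rightarrow>\<^sub>0 complex"
  have lie: "x \<in> perm.lie_elements n" using assms by (simp add: Lie_Sn_def)
  then have x: "x \<in> free_on (carrier (sym_group n))"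
    and defect: "\<And>m vs. m \<le> n \<Longrightarrow> vs \<in> perm.tuples n m \<Longrightarrow> perm.lie_defect m x vs \<in> perm.ext_rels n m"
    by (auto simp: perm.lie_elements_iff dim_Cn)
  have sum0: "(\<Sum>g\<in>Poly_Mapping.keys x. Poly_Mapping.lookup x g) = 0"
    using lie by (rule perm.lie_elements_sum_coeffs)
  have permutes: "g permutes {1..n}" if "g \<in> Poly_Mapping.keys x" for g
    using x that by (auto simp: free_on_def sym_group_carrier)
  have fixes_e: "perm_act g ?e = ?e" if "g \<in> Poly_Mapping.keys x" for g
    using permutes_not_in[OF permutes[OF that], of "Suc n"] by (simp add: perm_act_def)
  have x': "x \<in> free_on (carrier (sym_group (Suc n)))"
    using permutes permutes_subset[of _ "{1..n}" "{1..Suc n}"]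
    by (force simp: free_on_def sym_group_carrier)
  have basis: "perm.lie_defect m x us \<in> perm.ext_rels (Suc n) m"
    if us: "length us = m" "set us \<subseteq> fvec ` {1..Suc n}" "distinct us" for m us
  proof -
    \<comment> \<open>The hypothesis on \<open>x\<close> covers only degrees up to \<open>n\<close>.
      Distinct entries taken from \<open>n\<close> basis vectors keep the length within that
      bound.\<close>
    have small: "perm.lie_defect (length ws) x ws \<in> perm.ext_rels n (length ws)"
      if ws: "set ws \<subseteq> fvec ` {1..n}" "distinct ws" for ws
    proof (rule defect)
      have "length ws = card (set ws)" using ws(2) by (simp add: distinct_card)
      also have "\<dots> \<le> card (fvec ` {1..n} :: (nat \<Rightarrow>\<^sub>0 complex) set)"
        using ws(1) by (intro card_mono) auto
      also have "\<dots> \<le> n" using card_image_le[of "{1..n}" fvec] by simp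
      finally show "length ws \<le> n" .
      show "ws \<in> perm.tuples n (length ws)"
        using ws(1) unfolding perm.tuples_def by (auto simp: Cn_def fvec_in_free_on)
    qed
    show ?thesis
    proof (cases "?e \<in> set us")
      case False
      with us have "set us \<subseteq> fvec ` {1..n}" by (auto simp: atLeastAtMostSuc_conv)
      then show ?thesis using small[of us] us ext_rels_Suc_mono[of n m] by auto
    next
      case True
      then obtain as bs where ab: "us = as @ ?e # bs" by (meson split_list)
      let ?k = "length as" and ?ws = "as @ bs"
      have ins: "us = insert_at ?k ?e ?ws" by (simp add: insert_at_def ab)
      have m: "m = Suc (length ?ws)" using us ab by simp
      \<comment> \<open>Since \<open>us\<close> is distinct, \<open>?e\<close> does not occur again
        in \<open>?ws\<close>.\<close>
      have "set ?ws \<subseteq> fvec ` {1..n}" "distinct ?ws"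
        using us ab by (auto simp: atLeastAtMostSuc_conv)
      from ext_rels_insert_at[OF _ small[OF this], of ?e ?k]
      have "lin_ext (\<lambda>us. fvec (insert_at ?k ?e us)) (perm.lie_defect (length ?ws) x ?ws)
          \<in> perm.ext_rels (Suc n) m"
        unfolding m by (simp add: Cn_def fvec_in_free_on)
      then show ?thesis
        unfolding ins m
        \<comment> \<open>The correction term vanishes because the coefficients of \<open>x\<close>
          sum to zero.\<close>
        by (subst perm.lie_defect_insert_at) (simp_all add: fixes_e sum0)
    qed
  qed
  have "perm.lie_defect m x vs \<in> perm.ext_rels (Suc n) m" if "vs \<in> perm.tuples (Suc n) m" for m vs
    using perm.lie_defect_relators[OF x'] Cn_eq_span[symmetric] basis that
    by (rule perm.basis_tuples_suffice)
  then have "x \<in> perm.lie_elements (Suc n)"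
    using x' by (simp add: perm.lie_elements_iff)
  then show ?thesis by (simp add: Lie_Sn_def)
qed

theorem proposition4:
  fixes n :: nat
  assumes "n \<ge> 2"
  shows "std_embed_alg n ` Lie_Sn n \<subseteq> Lie_Sn (n + 1)"
proof
  fix y assume "y \<in> std_embed_alg n ` Lie_Sn n"
  then obtain x where x: "x \<in> Lie_Sn n" "y = std_embed_alg n x" by blast
  then have "x \<in> free_on (carrier (sym_group n))"
    by (simp add: Lie_Sn_def perm.lie_elements_def)
  then show "y \<in> Lie_Sn (n + 1)"
    using x Lie_Sn_Suc by (simp add: std_embed_alg_eq)
qed

end
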